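(* Let $G$ be a locally finite, recurrent graph which is quasi-isometric to $\mathbb{R}$. Then the real vector space $LH(G)$ of Lipschitz harmonic functions on $G$ has dimension equal to $2$.
   Context: Graphs carry the graph distance $d$. A function $h:V(G)\to\mathbb{R}$ is harmonic if for every vertex $v$, $h(v)=\frac{1}{d(v)}\sum_{u\sim v}h(u)$, where $d(v)$ is the degree of $v$ and $u\sim v$ means $uv$ is an edge. It is Lipschitz if there is a constant $C$ with $|h(v)-h(u)|<C$ for every edge $vu$. $LH(G)$ is the real vector space of Lipschitz harmonic functions on $G$. A graph is recurrent if simple random walk on it returns to its starting vertex almost surely. A quasi-isometry between metric spaces $(V,d)$ and $(V',d')$ is a map $f:V\to V'$ such that for fixed constants $M\ge 1$, $A\ge 0$: $M^{-1}d(x,y)-A\le d'(f(x),f(y))\le Md(x,y)+A$ for all $x,y\in V$, and every $z\in V'$ is within distance $A$ of some $f(x)$. *)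

theory Defs
  imports "HOL-Probability.Probability" "HOL-Library.Function_Algebras"
begin

text \<open>
  A graph is given by its adjacency relation \<open>E\<close>; its vertex set is the whole type \<open>'v\<close>.
\<close>

definition simple_graph :: "('v \<Rightarrow> 'v \<Rightarrow> bool) \<Rightarrow> bool" where
  "simple_graph E \<longleftrightarrow> symp E \<and> irreflp E"

definition connected_graph :: "('v \<Rightarrow> 'v \<Rightarrow> bool) \<Rightarrow> bool" where
  "connected_graph E \<longleftrightarrow> (\<forall>u v. E\<^sup>*\<^sup>* u v)"

definition nbrs :: "('v \<Rightarrow> 'v \<Rightarrow> bool) \<Rightarrow> 'v \<Rightarrow> 'v set" where
  "nbrs E v = {u. E v u}"

definition graph_degree :: "('v \<Rightarrow> 'v \<Rightarrow> bool) \<Rightarrow> 'v \<Rightarrow> nat" where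
  "graph_degree E v = card (nbrs E v)"

definition locally_finite :: "('v \<Rightarrow> 'v \<Rightarrow> bool) \<Rightarrow> bool" where
  "locally_finite E \<longleftrightarrow> (\<forall>v. finite (nbrs E v))"

text \<open>
  The length of a shortest walk; meaningful only when \<open>u\<close> and \<open>v\<close> lie in the same component.
\<close>

definition graph_dist :: "('v \<Rightarrow> 'v \<Rightarrow> bool) \<Rightarrow> 'v \<Rightarrow> 'v \<Rightarrow> real" where
  "graph_dist E u v = real (LEAST n. (E ^^ n) u v)"

definition quasi_isometry ::
    "('a \<Rightarrow> 'a \<Rightarrow> real) \<Rightarrow> ('b \<Rightarrow> 'b \<Rightarrow> real) \<Rightarrow> ('a \<Rightarrow> 'b) \<Rightarrow> bool" where
  "quasi_isometry d d' f \<longleftrightarrow>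
    (\<exists>M\<ge>1. \<exists>A\<ge>0.
      (\<forall>x y. inverse M * d x y - A \<le> d' (f x) (f y) \<and> d' (f x) (f y) \<le> M * d x y + A) \<and>
      (\<forall>z. \<exists>x. d' z (f x) \<le> A))"

definition quasi_isometric :: "('a \<Rightarrow> 'a \<Rightarrow> real) \<Rightarrow> ('b \<Rightarrow> 'b \<Rightarrow> real) \<Rightarrow> bool" where
  "quasi_isometric d d' \<longleftrightarrow> (\<exists>f. quasi_isometry d d' f)"


subsection \<open>Simple random walk\<close>

text \<open>
  The walk is held at a vertex without neighbours.
\<close>

definition srw_step :: "('v \<Rightarrow> 'v \<Rightarrow> bool) \<Rightarrow> 'v \<Rightarrow> 'v pmf" where
  "srw_step E v = (if nbrs E v = {} then return_pmf v else pmf_of_set (nbrs E v))"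

text \<open>
  The law of the \<open>n\<close>-th position given the positions at all earlier times.
\<close>

definition srw_kernel ::
    "('v \<Rightarrow> 'v \<Rightarrow> bool) \<Rightarrow> 'v \<Rightarrow> nat \<Rightarrow> (nat \<Rightarrow> 'v) \<Rightarrow> 'v measure" where
  "srw_kernel E v n \<omega> =
    measure_pmf (case n of 0 \<Rightarrow> return_pmf v | Suc m \<Rightarrow> srw_step E (\<omega> m))"

interpretation srw: Ionescu_Tulcea "srw_kernel E v" "\<lambda>_. count_space UNIV" for E v
proof (rule Ionescu_Tulcea.intro)
  fix i
  show "srw_kernel E v i \<in>
      Pi\<^sub>M {0..<i} (\<lambda>_. count_space UNIV) \<rightarrow>\<^sub>M subprob_algebra (count_space UNIV)"
  proof (cases i)
    case 0
    then show ?thesis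
      by (simp add: srw_kernel_def[abs_def] measure_pmf_in_subprob_algebra)
  next
    case (Suc m)
    have "(\<lambda>\<omega>. \<omega> m) \<in> Pi\<^sub>M {0..<i} (\<lambda>_. count_space UNIV) \<rightarrow>\<^sub>M count_space UNIV"
      using Suc by (intro measurable_component_singleton) auto
    moreover have "(\<lambda>x. measure_pmf (srw_step E x)) \<in>
        count_space UNIV \<rightarrow>\<^sub>M subprob_algebra (count_space UNIV)"
      by (simp add: measure_pmf_in_subprob_algebra)
    ultimately show ?thesis
      using Suc by (simp add: srw_kernel_def[abs_def])
  qed
qed (simp add: srw_kernel_def prob_space_measure_pmf)

definition srw :: "('v \<Rightarrow> 'v \<Rightarrow> bool) \<Rightarrow> 'v \<Rightarrow> (nat \<Rightarrow> 'v) measure" where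
  "srw E v = srw.PF.lim E v"

lemma sets_srw: "sets (srw E v) = sets (Pi\<^sub>M UNIV (\<lambda>_. count_space UNIV))"
  by (simp add: srw_def)

lemma prob_space_srw: "prob_space (srw E v)"
proof -
  have "emeasure (srw E v)
      (prod_emb UNIV (\<lambda>_. count_space UNIV) {} (space (Pi\<^sub>M {} (\<lambda>_. count_space UNIV)))) =
    emeasure (srw.CI E v {}) (space (Pi\<^sub>M {} (\<lambda>_. count_space UNIV)))"
    unfolding srw_def by (rule srw.lim) auto
  also have "\<dots> = 1"
    using prob_space.emeasure_space_1[OF srw.PF.prob_space_P[of "{}"]]
    by (simp add: srw.CI_def)
  finally show ?thesis
    by (intro prob_spaceI)
       (simp add: srw_def srw.PF.space_lim prod_emb_def space_PiM restrict_def vimage_def)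
qed

lemma emeasure_srw_cylinder:
  "emeasure (srw E v) {\<omega>. \<forall>i\<le>n. \<omega> i = x i} =
    ennreal (indicator {v} (x 0) * (\<Prod>i<n. pmf (srw_step E (x i)) (x (Suc i))))"
proof -
  let ?N = "\<lambda>_::nat. count_space (UNIV :: 'a set)"
  let ?cyl = "\<lambda>n. Pi\<^sub>E {0..<Suc n} (\<lambda>i. {x i})"
  have cyl[measurable]: "?cyl n \<in> sets (Pi\<^sub>M {0..<Suc n} ?N)" for n
    by (intro sets_PiM_I_finite) auto
  have C: "emeasure (srw.C E v 0 (Suc n) (\<lambda>_. undefined)) (?cyl n) =
    ennreal (indicator {v} (x 0) * (\<Prod>i<n. pmf (srw_step E (x i)) (x (Suc i))))" for n
  proof (induction n)
    case 0
    let ?u = "\<lambda>_::nat. undefined :: 'a"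
    have u: "?u \<in> space (Pi\<^sub>M {0..<0} ?N)"
      by (simp add: space_PiM)
    have "?u(0 := a) \<in> ?cyl 0 \<longleftrightarrow> a = x 0" for a
      unfolding PiE_iff extensional_def by simp
    then have vim: "(\<lambda>a. ?u(0 := a)) -` ?cyl 0 \<inter> space (?N 0) = {x 0}"
      unfolding space_count_space Int_UNIV_right vimage_def by (simp only: singleton_conv)
    have "srw.C E v 0 (Suc 0) ?u = return (Pi\<^sub>M {0..<0} ?N) ?u \<bind> srw.eP E v 0"
      by (simp only: srw.C.simps add_0_left)
    also have "\<dots> = srw.eP E v 0 ?u"
      by (rule bind_return[OF srw.measurable_eP u])
    finally have "emeasure (srw.C E v 0 (Suc 0) ?u) (?cyl 0) = emeasure (srw_kernel E v 0 ?u) {x 0}"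
      by (simp only: srw.emeasure_eP[OF u cyl] vim)
    also have "\<dots> = ennreal (indicator {v} (x 0))"
      by (simp add: srw_kernel_def emeasure_pmf_single indicator_def)
    finally show ?case
      by (simp only: lessThan_0 prod.empty mult_1_right)
  next
    case (Suc n)
    let ?M = "srw.C E v 0 (Suc n) (\<lambda>_. undefined)"
    have sets_M: "sets ?M = sets (Pi\<^sub>M {0..<Suc n} ?N)"
      using srw.sets_C[of "\<lambda>_. undefined" 0 E v "Suc n"] by (simp add: space_PiM)
    have space_M: "space ?M = space (Pi\<^sub>M {0..<Suc n} ?N)"
      using sets_M by (rule sets_eq_imp_space_eq)
    have eP: "emeasure (srw.eP E v (Suc n) \<omega>) (?cyl (Suc n)) =
        ennreal (pmf (srw_step E (x n)) (x (Suc n))) * indicator (?cyl n) \<omega>"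
      if "\<omega> \<in> space (Pi\<^sub>M {0..<Suc n} ?N)" for \<omega>
    proof -
      have "fun_upd \<omega> (Suc n) a \<in> ?cyl (Suc n) \<longleftrightarrow> a = x (Suc n) \<and> (\<forall>i\<in>{0..<Suc n}. \<omega> i = x i)" for a
      proof -
        have "fun_upd \<omega> (Suc n) a \<in> extensional {0..<Suc (Suc n)}"
          using that unfolding space_PiM PiE_iff extensional_def by simp
        moreover have "(\<forall>i\<in>{0..<Suc (Suc n)}. (fun_upd \<omega> (Suc n) a) i = x i) \<longleftrightarrow>
            a = x (Suc n) \<and> (\<forall>i\<in>{0..<Suc n}. \<omega> i = x i)"
          by (subst atLeastLessThanSuc) auto
        ultimately show ?thesis
          by (simp only: PiE_iff singleton_iff simp_thms)
      qed
      moreover have "\<omega> \<in> ?cyl n \<longleftrightarrow> (\<forall>i\<in>{0..<Suc n}. \<omega> i = x i)"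
        using that by (simp only: space_PiM PiE_iff singleton_iff simp_thms)
      ultimately have "(\<lambda>a. fun_upd \<omega> (Suc n) a) -` ?cyl (Suc n) = (if \<omega> \<in> ?cyl n then {x (Suc n)} else {})"
        by (auto simp only: vimage_def split: if_splits)
      moreover have "emeasure (srw_kernel E v (Suc n) \<omega>) (if \<omega> \<in> ?cyl n then {x (Suc n)} else {}) =
          ennreal (pmf (srw_step E (x n)) (x (Suc n))) * indicator (?cyl n) \<omega>"
      proof (cases "\<omega> \<in> ?cyl n")
        case True
        then have "\<omega> n = x n"
          by (auto dest: PiE_mem[of _ _ _ n])
        with True show ?thesis
          by (simp add: srw_kernel_def emeasure_pmf_single)
      qed simp
      ultimately show ?thesis
        by (simp only: srw.emeasure_eP[OF that cyl] space_count_space Int_UNIV_right)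
    qed
    have "emeasure (srw.C E v 0 (Suc (Suc n)) (\<lambda>_. undefined)) (?cyl (Suc n)) =
        emeasure (?M \<bind> srw.eP E v (Suc n)) (?cyl (Suc n))"
      by (simp only: srw.C.simps add_0_left)
    also have "\<dots> = (\<integral>\<^sup>+\<omega>. emeasure (srw.eP E v (Suc n) \<omega>) (?cyl (Suc n)) \<partial>?M)"
      using srw.measurable_eP[of E v "Suc n"]
      by (intro emeasure_bind[where N="Pi\<^sub>M {0..<Suc (Suc n)} ?N"])
         (auto simp: space_M space_PiM_empty_iff measurable_cong_sets[OF sets_M refl] simp del: srw.C.simps)
    also have "\<dots> = (\<integral>\<^sup>+\<omega>. ennreal (pmf (srw_step E (x n)) (x (Suc n))) * indicator (?cyl n) \<omega> \<partial>?M)"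
      by (intro nn_integral_cong eP) (simp add: space_M del: srw.C.simps)
    also have "\<dots> = ennreal (pmf (srw_step E (x n)) (x (Suc n))) * emeasure ?M (?cyl n)"
      by (intro nn_integral_cmult_indicator) (simp add: sets_M cyl del: srw.C.simps)
    finally show ?case
      unfolding Suc.IH by (simp add: ennreal_mult[symmetric] prod_nonneg mult_ac)
  qed
  have "{\<omega>. \<forall>i\<le>n. \<omega> i = x i} = prod_emb UNIV ?N {0..<Suc n} (?cyl n)"
    by (auto simp: prod_emb_def PiE_iff less_Suc_eq_le)
  then have "emeasure (srw E v) {\<omega>. \<forall>i\<le>n. \<omega> i = x i} = emeasure (srw.CI E v {0..<Suc n}) (?cyl n)"
    unfolding srw_def by (simp only:) (rule srw.lim, auto)
  also have "\<dots> = emeasure (srw.C E v 0 (Suc n) (\<lambda>_. undefined))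
      (prod_emb {0..<Suc n} ?N {0..<Suc n} (?cyl n))"
    by (rule srw.emeasure_CI) auto
  also have "prod_emb {0..<Suc n} ?N {0..<Suc n} (?cyl n) = ?cyl n"
    by (intro prod_emb_id) auto
  finally show ?thesis
    unfolding C .
qed

definition recurrent :: "('v \<Rightarrow> 'v \<Rightarrow> bool) \<Rightarrow> bool" where
  "recurrent E \<longleftrightarrow> (\<forall>v. AE \<omega> in srw E v. \<exists>n\<ge>1. \<omega> n = v)"


subsection \<open>Lipschitz harmonic functions\<close>

definition harmonic :: "('v \<Rightarrow> 'v \<Rightarrow> bool) \<Rightarrow> ('v \<Rightarrow> real) \<Rightarrow> bool" where
  "harmonic E h \<longleftrightarrow> (\<forall>v. h v = 1 / real (graph_degree E v) * (\<Sum>u\<in>nbrs E v. h u))"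

definition lipschitz :: "('v \<Rightarrow> 'v \<Rightarrow> bool) \<Rightarrow> ('v \<Rightarrow> real) \<Rightarrow> bool" where
  "lipschitz E h \<longleftrightarrow> (\<exists>C. \<forall>u v. E v u \<longrightarrow> \<bar>h v - h u\<bar> < C)"

definition LH :: "('v \<Rightarrow> 'v \<Rightarrow> bool) \<Rightarrow> ('v \<Rightarrow> real) set" where
  "LH E = {h. lipschitz E h \<and> harmonic E h}"

instantiation "fun" :: (type, real_vector) real_vector
begin

definition scaleR_fun :: "real \<Rightarrow> ('a \<Rightarrow> 'b) \<Rightarrow> 'a \<Rightarrow> 'b" where
  "scaleR_fun c f = (\<lambda>x. c *\<^sub>R f x)"

instance
  by standard (auto simp: scaleR_fun_def fun_eq_iff algebra_simps)

end

lemma subspace_LH: "subspace (LH E)"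
proof (rule subspaceI)
  show "0 \<in> LH E"
    by (auto simp: LH_def lipschitz_def harmonic_def intro: exI[of _ 1])
next
  fix g h assume g: "g \<in> LH E" and h: "h \<in> LH E"
  from g h obtain C D where
    C: "\<And>u v. E v u \<Longrightarrow> \<bar>g v - g u\<bar> < C" and D: "\<And>u v. E v u \<Longrightarrow> \<bar>h v - h u\<bar> < D"
    unfolding LH_def lipschitz_def by blast
  have "\<bar>(g + h) v - (g + h) u\<bar> < C + D" if "E v u" for u v
    using C[OF that] D[OF that] by simp
  moreover have "harmonic E (g + h)"
    unfolding harmonic_def
  proof
    fix v
    have "g v = 1 / real (graph_degree E v) * (\<Sum>u\<in>nbrs E v. g u)"
      "h v = 1 / real (graph_degree E v) * (\<Sum>u\<in>nbrs E v. h u)"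
      using g h unfolding LH_def harmonic_def by blast+
    then show "(g + h) v = 1 / real (graph_degree E v) * (\<Sum>u\<in>nbrs E v. (g + h) u)"
      by (simp add: sum.distrib distrib_left add_divide_distrib)
  qed
  ultimately show "g + h \<in> LH E"
    unfolding LH_def lipschitz_def by blast
next
  fix c :: real and h assume h: "h \<in> LH E"
  then obtain C where C: "\<And>u v. E v u \<Longrightarrow> \<bar>h v - h u\<bar> < C"
    unfolding LH_def lipschitz_def by blast
  have "\<bar>(c *\<^sub>R h) v - (c *\<^sub>R h) u\<bar> < \<bar>c\<bar> * C + 1" if "E v u" for u v
  proof -
    have "\<bar>(c *\<^sub>R h) v - (c *\<^sub>R h) u\<bar> = \<bar>c\<bar> * \<bar>h v - h u\<bar>"
      by (simp add: scaleR_fun_def abs_mult[symmetric] right_diff_distrib)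
    also have "\<dots> \<le> \<bar>c\<bar> * C"
      using C[OF that] by (intro mult_left_mono) auto
    finally show ?thesis by simp
  qed
  moreover have "harmonic E (c *\<^sub>R h)"
    unfolding harmonic_def
  proof
    fix v
    have "h v = 1 / real (graph_degree E v) * (\<Sum>u\<in>nbrs E v. h u)"
      using h unfolding LH_def harmonic_def by blast
    then show "(c *\<^sub>R h) v = 1 / real (graph_degree E v) * (\<Sum>u\<in>nbrs E v. (c *\<^sub>R h) u)"
      by (simp add: scaleR_fun_def sum_distrib_left[symmetric])
  qed
  ultimately show "c *\<^sub>R h \<in> LH E"
    unfolding LH_def lipschitz_def by blast
qed

end

theory Submission
  imports Defs "HOL-Complex_Analysis.Great_Picard"
begin

text \<open>
  A quasi-isometry to the line cuts the graph along finite edge boundaries, and the flux of a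
  harmonic function through such a cut does not change when the cut is modified on a finite set.

  Upper bound: recurrence forces a nonconstant harmonic function to be unbounded above and below.
  If it is Lipschitz, its oscillation over slices of the line is bounded, so by the minimum principle it
  tends to \<open>+\<infinity>\<close> at one end and to \<open>-\<infinity>\<close> at the other. Its sublevel sets are then admissible
  cuts, through which the flux is visibly nonzero. So the flux is a linear functional on the space
  of Lipschitz harmonic functions whose kernel consists of the constants.

  Existence: solve a Dirichlet problem with values 0 and 1 on the two sides of a large window and
  normalise the flux to 1. Looking at sublevel sets again, every edge difference is at most the flux,
  so these functions are 1-Lipschitz, and a pointwise limit has unit flux.
\<close>

section \<open>Laplacian, cuts and flux\<close>

definition laplacian :: "('v \<Rightarrow> 'v \<Rightarrow> bool) \<Rightarrow> ('v \<Rightarrow> real) \<Rightarrow> 'v \<Rightarrow> real" where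
  "laplacian E h v = (\<Sum>u\<in>nbrs E v. h u - h v)"

text \<open>Pairs point out of \<open>S\<close>, so each crossing edge is listed once and the flux
  has a sign.\<close>

definition edge_boundary :: "('v \<Rightarrow> 'v \<Rightarrow> bool) \<Rightarrow> 'v set \<Rightarrow> ('v \<times> 'v) set" where
  "edge_boundary E S = {(u, v). u \<in> S \<and> v \<notin> S \<and> E u v}"

definition flux :: "('v \<Rightarrow> 'v \<Rightarrow> bool) \<Rightarrow> ('v \<Rightarrow> real) \<Rightarrow> 'v set \<Rightarrow> real" where
  "flux E h S = (\<Sum>(u, v)\<in>edge_boundary E S. h v - h u)"

text \<open>The probability that the walk from \<open>z\<close> avoids \<open>b\<close> at the times \<open>1, \<dots>, n\<close>.\<close>

primrec avoid :: "('v \<Rightarrow> 'v \<Rightarrow> bool) \<Rightarrow> 'v \<Rightarrow> nat \<Rightarrow> 'v \<Rightarrow> real" where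
  "avoid E b 0 z = 1"
| "avoid E b (Suc n) z = (\<Sum>y\<in>nbrs E z - {b}. avoid E b n y) / real (graph_degree E z)"

section \<open>Avoidance probabilities of simple random walk\<close>

lemma sets_srw_Collect:
  assumes "Measurable.pred (Pi\<^sub>M UNIV (\<lambda>_. count_space UNIV)) P"
  shows "{\<omega>. P \<omega>} \<in> sets (srw E v)"
  using assms by (simp add: sets_srw pred_def space_PiM)

lemma measure_srw_cylinder:
  "measure (srw E v) {\<omega>. \<forall>i\<le>n. \<omega> i = x i} =
    indicator {v} (x 0) * (\<Prod>i<n. pmf (srw_step E (x i)) (x (Suc i)))"
  unfolding measure_def emeasure_srw_cylinder by (simp add: prod_nonneg)

text \<open>Takes the place of the Markov property at time \<open>k\<close>, using cylinder
  probabilities alone. The induction splits on the position at time \<open>k + 1\<close>, which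
  lengthens the cylinder; hence \<open>k\<close> and \<open>x\<close> are arbitrary.\<close>

lemma measure_srw_cylinder_avoid:
  fixes E :: "'v \<Rightarrow> 'v \<Rightarrow> bool"
  assumes fin: "\<And>z. finite (nbrs E z)" and ne: "\<And>z. nbrs E z \<noteq> {}"
  shows "measure (srw E v) {\<omega>. \<forall>i\<le>k. \<omega> i = x i} * avoid E b n (x k)
    \<le> measure (srw E v) {\<omega>. (\<forall>i\<le>k. \<omega> i = x i) \<and> (\<forall>i\<in>{k<..k+n}. \<omega> i \<noteq> b)}"
proof (induction n arbitrary: k x)
  case 0
  then show ?case by simp
next
  case (Suc n)
  interpret prob_space "srw E v" by (rule prob_space_srw)
  let ?c = "measure (srw E v) {\<omega>. \<forall>i\<le>k. \<omega> i = x i}"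
  let ?N = "nbrs E (x k) - {b}"
  let ?x = "\<lambda>y. x(Suc k := y)"
  let ?C = "\<lambda>y. {\<omega>. (\<forall>i\<le>Suc k. \<omega> i = ?x y i) \<and> (\<forall>i\<in>{Suc k<..Suc k+n}. \<omega> i \<noteq> b)}"
  have meas: "{\<omega>. (\<forall>i\<le>k. \<omega> i = x i) \<and> (\<forall>i\<in>I. \<omega> i \<noteq> b)} \<in> sets (srw E v)" for k x and I :: "nat set"
    by (rule sets_srw_Collect) measurable
  have cyl: "measure (srw E v) {\<omega>. \<forall>i\<le>Suc k. \<omega> i = ?x y i} = ?c / real (graph_degree E (x k))"
    if "y \<in> ?N" for y
  proof -
    have "(\<Prod>i<k. pmf (srw_step E (?x y i)) (?x y (Suc i))) = (\<Prod>i<k. pmf (srw_step E (x i)) (x (Suc i)))"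
      by (intro prod.cong) auto
    moreover have "pmf (srw_step E (x k)) y = 1 / real (graph_degree E (x k))"
      using that fin ne by (simp add: srw_step_def graph_degree_def)
    ultimately show ?thesis
      unfolding measure_srw_cylinder by (simp add: mult_ac)
  qed
  have "?c * avoid E b (Suc n) (x k) = (\<Sum>y\<in>?N. ?c / real (graph_degree E (x k)) * avoid E b n (?x y (Suc k)))"
    by (simp add: sum_distrib_left sum_divide_distrib)
  also have "\<dots> \<le> (\<Sum>y\<in>?N. measure (srw E v) (?C y))"
  proof (rule sum_mono)
    fix y assume "y \<in> ?N"
    from cyl[OF this] Suc.IH[of "Suc k" "?x y"]
    show "?c / real (graph_degree E (x k)) * avoid E b n (?x y (Suc k)) \<le> measure (srw E v) (?C y)"
      by (simp only:)
  qed
  also have "\<dots> = measure (srw E v) (\<Union>y\<in>?N. ?C y)"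
  proof (rule finite_measure_finite_Union[symmetric])
    show "disjoint_family_on ?C ?N"
      by (auto simp: disjoint_family_on_def)
    show "?C ` ?N \<subseteq> sets (srw E v)"
      using meas by blast
  qed (use fin in simp)
  also have "\<dots> \<le> measure (srw E v) {\<omega>. (\<forall>i\<le>k. \<omega> i = x i) \<and> (\<forall>i\<in>{k<..k+Suc n}. \<omega> i \<noteq> b)}"
  proof (rule finite_measure_mono)
    show "(\<Union>y\<in>?N. ?C y) \<subseteq> {\<omega>. (\<forall>i\<le>k. \<omega> i = x i) \<and> (\<forall>i\<in>{k<..k+Suc n}. \<omega> i \<noteq> b)}"
    proof clarify
      fix y \<omega> assume y: "y \<in> nbrs E (x k)" "y \<noteq> b" and 1: "\<forall>i\<le>Suc k. \<omega> i = ?x y i"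
        and 2: "\<forall>i\<in>{Suc k<..Suc k+n}. \<omega> i \<noteq> b"
      have "\<omega> i = x i" if "i \<le> k" for i
        using 1 that by auto
      moreover have "\<omega> i \<noteq> b" if "i \<in> {k<..k+Suc n}" for i
        using 1 2 y that by (cases "i = Suc k") auto
      ultimately show "(\<forall>i\<le>k. \<omega> i = x i) \<and> (\<forall>i\<in>{k<..k+Suc n}. \<omega> i \<noteq> b)"
        by blast
    qed
  qed (rule meas)
  finally show ?case .
qed

lemma avoid_nonneg: "0 \<le> avoid E b n z"
  by (induction n arbitrary: z) (auto intro!: sum_nonneg divide_nonneg_nonneg)

text \<open>The events of not returning to \<open>b\<close> up to time \<open>n\<close> decrease to
  never returning, which is null by recurrence.\<close>

lemma avoid_recurrent_tendsto_0:
  fixes E :: "'v \<Rightarrow> 'v \<Rightarrow> bool"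
  assumes fin: "\<And>z. finite (nbrs E z)" and ne: "\<And>z. nbrs E z \<noteq> {}" and rec: "recurrent E"
  shows "(\<lambda>n. avoid E b n b) \<longlonglongrightarrow> 0"
proof -
  interpret prob_space "srw E b" by (rule prob_space_srw)
  let ?D = "\<lambda>n. {\<omega>. (\<forall>i\<le>0. \<omega> i = b) \<and> (\<forall>i\<in>{0<..0+n}. \<omega> i \<noteq> b)}"
  have meas: "?D n \<in> sets (srw E b)" for n
    by (rule sets_srw_Collect) measurable
  have "measure (srw E b) {\<omega>. \<forall>i\<le>0. \<omega> i = (\<lambda>_. b) i} = 1"
    unfolding measure_srw_cylinder by simp
  then have le: "avoid E b n b \<le> measure (srw E b) (?D n)" for n
    using measure_srw_cylinder_avoid[OF fin ne, where v=b and k=0 and x="\<lambda>_. b" and b=b and n=n] by simp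
  have "(\<lambda>n. measure (srw E b) (?D n)) \<longlonglongrightarrow> measure (srw E b) (\<Inter>n. ?D n)"
    using meas by (intro finite_Lim_measure_decseq) (auto simp: decseq_def)
  moreover have "measure (srw E b) (\<Inter>n. ?D n) = 0"
  proof -
    have "AE \<omega> in srw E b. \<exists>n\<ge>1. \<omega> n = b"
      using rec by (simp add: recurrent_def)
    then have "AE \<omega> in srw E b. \<omega> \<notin> (\<Inter>n. ?D n)"
      by eventually_elim force
    then show ?thesis
      using meas by (subst prob_eq_0) auto
  qed
  ultimately have "(\<lambda>n. measure (srw E b) (?D n)) \<longlonglongrightarrow> 0"
    by simp
  then show ?thesis
    by (rule tendsto_sandwich[OF always_eventually always_eventually tendsto_const, rotated 2])
      (use avoid_nonneg le in auto)
qed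

section \<open>Minimum principle on infinite connected graphs\<close>

locale lfc_graph =
  fixes E :: "'v \<Rightarrow> 'v \<Rightarrow> bool"
  assumes sym: "E u v \<Longrightarrow> E v u"
    and irrefl: "\<not> E u u"
    and connected: "E\<^sup>*\<^sup>* u v"
    and finite_nbrs: "finite (nbrs E u)"
    and infinite_verts: "infinite (UNIV :: 'v set)"
begin

lemma closed_set_UNIV:
  assumes "x \<in> S" and "\<And>u v. u \<in> S \<Longrightarrow> E u v \<Longrightarrow> v \<in> S"
  shows "y \<in> S"
  using connected[of x y] by induction (use assms in auto)

lemma nbrs_nonempty: "nbrs E u \<noteq> {}"
proof
  assume "nbrs E u = {}"
  then have "y \<in> {u}" for y
    by (rule_tac closed_set_UNIV[of u]) (auto simp: nbrs_def)
  then have "UNIV = {u}" by auto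
  then show False using infinite_verts by (metis finite.emptyI finite_insert)
qed

lemma degree_pos: "0 < graph_degree E u"
  using nbrs_nonempty finite_nbrs by (simp add: graph_degree_def card_gt_0_iff)

lemma laplacian_eq_0_iff:
  "laplacian E h v = 0 \<longleftrightarrow> h v = 1 / real (graph_degree E v) * (\<Sum>u\<in>nbrs E v. h u)"
proof -
  have "laplacian E h v = (\<Sum>u\<in>nbrs E v. h u) - real (graph_degree E v) * h v"
    by (simp add: laplacian_def sum_subtractf graph_degree_def)
  then show ?thesis using degree_pos[of v] by (auto simp: field_simps)
qed

lemma harmonic_iff_laplacian: "harmonic E h \<longleftrightarrow> (\<forall>v. laplacian E h v = 0)"
  by (simp add: harmonic_def laplacian_eq_0_iff)

lemma laplacian_local_min:
  assumes "laplacian E h v = 0" and "\<And>u. E v u \<Longrightarrow> h v \<le> h u" and "E v u"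
  shows "h u = h v"
proof -
  have "\<forall>u\<in>nbrs E v. h u - h v = 0"
    using assms(1,2) finite_nbrs unfolding laplacian_def
    by (subst (asm) sum_nonneg_eq_0_iff) (auto simp: nbrs_def)
  then show ?thesis using assms(3) by (simp add: nbrs_def)
qed

lemma nonconstant_imp_edge:
  fixes h :: "'v \<Rightarrow> real"
  assumes "h x \<noteq> h y"
  obtains u v where "E u v" "h u < h v"
proof -
  have "\<exists>u v. E u v \<and> h u \<noteq> h v"
  proof (rule ccontr)
    assume "\<not> ?thesis"
    then have step: "\<And>u v. u \<in> {z. h z = h x} \<Longrightarrow> E u v \<Longrightarrow> v \<in> {z. h z = h x}"
      by (metis mem_Collect_eq)
    have "y \<in> {z. h z = h x}"
      by (rule closed_set_UNIV[of x]) (simp, rule step)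
    then show False using assms by simp
  qed
  then show ?thesis using that sym by (metis linorder_neqE)
qed

text \<open>If the minimum over \<open>W\<close> were below \<open>c\<close>, a minimiser would have
  all its neighbours in \<open>W\<close>, and they would be minimisers too. By connectedness
  \<open>W\<close> would be the whole infinite graph.\<close>

lemma minimum_principle:
  assumes harm: "harmonic E h" and W: "finite W"
    and bd: "\<And>w. w \<in> W \<Longrightarrow> c \<le> h w \<or> nbrs E w \<subseteq> W" and y: "y \<in> W"
  shows "c \<le> h y"
proof (rule ccontr)
  assume "\<not> c \<le> h y"
  define m where "m = Min (h ` W)"
  have m_le: "m \<le> h w" if "w \<in> W" for w
    using that W by (simp add: m_def)
  have "m < c" using m_le[OF y] \<open>\<not> c \<le> h y\<close> by linarith
  have "m \<in> h ` W" using W y unfolding m_def by (intro Min_in) auto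
  then obtain w where w: "w \<in> W" "h w = m" by auto
  have "z \<in> {w\<in>W. h w = m}" for z
  proof (rule closed_set_UNIV)
    show "w \<in> {w\<in>W. h w = m}" using w by simp
    fix u v assume u: "u \<in> {w\<in>W. h w = m}" and uv: "E u v"
    then have sub: "nbrs E u \<subseteq> W" using bd[of u] \<open>m < c\<close> by auto
    then have "h v = h u"
      using u uv m_le harm
      by (intro laplacian_local_min) (auto simp: harmonic_iff_laplacian nbrs_def subset_iff)
    then show "v \<in> {w\<in>W. h w = m}" using u uv sub by (auto simp: nbrs_def)
  qed
  then have "UNIV \<subseteq> W" by auto
  then show False using W infinite_verts finite_subset by blast
qed

section \<open>Recurrence and the Liouville property\<close>

lemma avoid_le_1: "avoid E b n z \<le> 1"
proof (induction n arbitrary: z)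
  case (Suc n)
  have "(\<Sum>y\<in>nbrs E z - {b}. avoid E b n y) \<le> (\<Sum>y\<in>nbrs E z - {b}. 1)"
    by (intro sum_mono Suc)
  also have "\<dots> \<le> real (graph_degree E z)"
    using finite_nbrs by (auto simp: graph_degree_def intro!: card_mono)
  finally show ?case using degree_pos[of z] by simp
qed simp

lemma avoid_antimono: "avoid E b (Suc n) z \<le> avoid E b n z"
proof (induction n arbitrary: z)
  case 0
  then show ?case using avoid_le_1[of b "Suc 0" z] by simp
next
  case (Suc n)
  show ?case
    unfolding avoid.simps(2)[of E b "Suc n" z] avoid.simps(2)[of E b n z]
    by (intro divide_right_mono sum_mono Suc) simp
qed

text \<open>Recurrence gives this for the starting point \<open>b\<close> only. In general the limit
  is a nonnegative harmonic function of \<open>z\<close> with a zero, hence a minimum, at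
  \<open>b\<close>, so it vanishes identically.\<close>

lemma avoid_tendsto_0:
  assumes "recurrent E"
  shows "(\<lambda>n. avoid E b n z) \<longlonglongrightarrow> 0"
proof -
  have "\<exists>r. (\<lambda>n. avoid E b n z) \<longlonglongrightarrow> r" for z
    using decseq_convergent[of "\<lambda>n. avoid E b n z" 0] avoid_nonneg avoid_antimono
    by (metis decseq_SucI)
  then obtain r where r: "\<And>z. (\<lambda>n. avoid E b n z) \<longlonglongrightarrow> r z" by metis
  have rb: "r b = 0"
    using r[of b] avoid_recurrent_tendsto_0[OF finite_nbrs nbrs_nonempty assms, of b]
    by (rule LIMSEQ_unique)
  have r_nonneg: "0 \<le> r z" for z
    using r[of z] by (rule LIMSEQ_le_const) (use avoid_nonneg[of E b _ z] in blast)
  have "(\<lambda>n. avoid E b (Suc n) z) \<longlonglongrightarrow> (\<Sum>y\<in>nbrs E z - {b}. r y) / real (graph_degree E z)" for z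
    using degree_pos[of z] unfolding avoid.simps by (intro tendsto_intros r) auto
  then have r_eq: "r z = (\<Sum>y\<in>nbrs E z - {b}. r y) / real (graph_degree E z)" for z
    using LIMSEQ_unique LIMSEQ_Suc[OF r] by blast
  \<comment> \<open>As \<open>r b = 0\<close>, the missing summand can be restored, which turns the
    recursion into harmonicity of \<open>r\<close>.\<close>
  have sum_eq: "(\<Sum>y\<in>nbrs E z - {b}. r y) = (\<Sum>y\<in>nbrs E z. r y)" for z
    using finite_nbrs rb by (intro sum.mono_neutral_left) auto
  have lap: "laplacian E r z = 0" for z
    unfolding laplacian_eq_0_iff using r_eq[of z, unfolded sum_eq] by (metis mult_1_left times_divide_eq_left)
  have "z \<in> {z. r z = 0}"
  proof (rule closed_set_UNIV)
    show "b \<in> {z. r z = 0}" using rb by simp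
    fix u v assume u: "u \<in> {z. r z = 0}" and "E u v"
    then have "r v = r u"
      using r_nonneg lap by (intro laplacian_local_min) auto
    then show "v \<in> {z. r z = 0}" using u by simp
  qed
  then show ?thesis using r[of z] by simp
qed

text \<open>Stopping the walk from \<open>z\<close> at its first visit to \<open>b\<close> gives \<open>h z \<ge> h b (1 - avoid E b n z)\<close>.\<close>

lemma liouville_nonneg:
  assumes rec: "recurrent E" and harm: "harmonic E h" and nonneg: "\<And>z. 0 \<le> h z"
  shows "h x = h y"
proof -
  have ge: "h b * (1 - avoid E b n z) \<le> h z" for b n z
  proof (induction n arbitrary: z)
    case 0
    then show ?case using nonneg by simp
  next
    case (Suc n)
    let ?d = "real (graph_degree E z)"
    let ?N = "nbrs E z"
    \<comment> \<open>At the neighbour \<open>b\<close> the bound is \<open>h b\<close> itself, as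
      the walk has arrived; at the others it is the induction hypothesis.\<close>
    have "h b * (?d - (\<Sum>y\<in>?N - {b}. avoid E b n y))
        = (\<Sum>y\<in>?N. h b * (1 - (if y = b then 0 else avoid E b n y)))"
    proof -
      have "(\<Sum>y\<in>?N - {b}. avoid E b n y) = (\<Sum>y\<in>?N. if y = b then 0 else avoid E b n y)"
        using finite_nbrs by (intro sum.mono_neutral_cong_left) auto
      then show ?thesis
        by (simp add: sum_distrib_left[symmetric] sum_subtractf graph_degree_def)
    qed
    also have "\<dots> \<le> (\<Sum>y\<in>?N. h y)"
      using Suc by (intro sum_mono) auto
    also have "\<dots> = ?d * h z"
    proof -
      have "h z = 1 / ?d * (\<Sum>y\<in>?N. h y)"
        using harm unfolding harmonic_def by (rule spec)
      then have "?d * h z = ?d * (1 / ?d * (\<Sum>y\<in>?N. h y))"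
        by (rule arg_cong)
      then show ?thesis using degree_pos[of z] by simp
    qed
    finally show ?case
      using degree_pos[of z] by (simp add: field_simps)
  qed
  have "h b \<le> h z" for b z
  proof (rule LIMSEQ_le_const2)
    show "(\<lambda>n. h b * (1 - avoid E b n z)) \<longlonglongrightarrow> h b"
      using tendsto_mult[OF tendsto_const tendsto_diff[OF tendsto_const avoid_tendsto_0[OF rec, of b z]], of "h b" 1]
      by simp
  qed (use ge in auto)
  then show ?thesis by (metis antisym)
qed

section \<open>Flux under finite changes of the cut\<close>

text \<open>A boundary edge of \<open>T\<close> but not of \<open>S\<close> has an endpoint in the
  finite symmetric difference; \<open>prod.swap\<close> covers the second endpoint.\<close>

lemma finite_edge_boundary_cong:
  assumes "finite (edge_boundary E S)" and D: "finite (S - T \<union> (T - S))"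
  shows "finite (edge_boundary E T)"
proof -
  let ?D = "S - T \<union> (T - S)"
  have "edge_boundary E T \<subseteq> edge_boundary E S \<union> (SIGMA u:?D. nbrs E u) \<union> prod.swap ` (SIGMA u:?D. nbrs E u)"
    using sym by (auto simp: edge_boundary_def nbrs_def image_iff)
  moreover have "finite (SIGMA u:?D. nbrs E u)"
    using D finite_nbrs by (intro finite_SigmaI) auto
  ultimately show ?thesis
    using assms(1) by (meson finite_Un finite_imageI finite_subset)
qed

text \<open>Edges from \<open>S\<close> to \<open>x\<close> cease to cross, edges from
  \<open>x\<close> to the outside begin to. Either way the change is \<open>h u - h x\<close>, with
  \<open>u\<close> the other endpoint.\<close>

lemma flux_insert:
  assumes "finite (edge_boundary E S)" and "x \<notin> S"
  shows "flux E h (insert x S) = flux E h S + laplacian E h x"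
proof -
  let ?f = "\<lambda>(u, v). h v - h u"
  let ?O = "nbrs E x - S" and ?I = "nbrs E x \<inter> S"
  let ?in = "(\<lambda>u. (u, x)) ` ?I" and ?out = "(\<lambda>v. (x, v)) ` ?O"
  have in_sub: "?in \<subseteq> edge_boundary E S"
    using assms sym by (auto simp: edge_boundary_def nbrs_def)
  have "edge_boundary E (insert x S) = (edge_boundary E S - ?in) \<union> ?out"
    using assms(2) sym irrefl by (auto simp: edge_boundary_def nbrs_def)
  then have "flux E h (insert x S) = sum ?f (edge_boundary E S - ?in) + sum ?f ?out"
    unfolding flux_def
    using assms finite_nbrs by (simp only:) (intro sum.union_disjoint, auto simp: edge_boundary_def)
  also have "sum ?f (edge_boundary E S - ?in) = flux E h S - sum ?f ?in"
    unfolding flux_def using in_sub assms(1) by (simp add: sum_diff)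
  also have "sum ?f ?in = - (\<Sum>u\<in>?I. h u - h x)"
    by (subst sum.reindex) (auto simp: inj_on_def sum_negf[symmetric])
  also have "sum ?f ?out = (\<Sum>u\<in>?O. h u - h x)"
    by (subst sum.reindex) (auto simp: inj_on_def)
  finally show ?thesis
    using sum.Int_Diff[OF finite_nbrs, of "\<lambda>u. h u - h x" x S] by (simp add: laplacian_def)
qed

lemma flux_Un:
  assumes "finite T" and "finite (edge_boundary E S)" and "T \<inter> S = {}"
    and "\<And>x. x \<in> T \<Longrightarrow> laplacian E h x = 0"
  shows "flux E h (S \<union> T) = flux E h S"
  using assms(1,3,4)
proof (induction T rule: finite_induct)
  case (insert x T)
  have "finite (edge_boundary E (S \<union> T))"
    using assms(2) by (rule finite_edge_boundary_cong) (use insert in \<open>auto intro: finite_subset[of _ T]\<close>)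
  then have "flux E h (insert x (S \<union> T)) = flux E h (S \<union> T) + laplacian E h x"
    by (rule flux_insert) (use insert in auto)
  then show ?case using insert by auto
qed simp

text \<open>Both cuts are enlarged to their union, so that vertices are only ever added.\<close>

lemma flux_cong:
  assumes bd: "finite (edge_boundary E S)" and D: "finite (S - T \<union> (T - S))"
    and "\<And>x. x \<in> S - T \<union> (T - S) \<Longrightarrow> laplacian E h x = 0"
  shows "flux E h T = flux E h S"
proof -
  have "flux E h (S \<union> (T - S)) = flux E h S"
    using assms by (intro flux_Un) auto
  moreover have "flux E h (T \<union> (S - T)) = flux E h T"
    using assms finite_edge_boundary_cong[OF bd D] by (intro flux_Un) auto
  moreover have "S \<union> (T - S) = T \<union> (S - T)" by auto
  ultimately show ?thesis by simp
qed

text \<open>Through the boundary of a sublevel set all contributions to the flux are positive.\<close>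

lemma edge_le_flux:
  assumes bd: "finite (edge_boundary E S)" and "E u v" and "h u < h v"
    and D: "finite ({x. x \<in> S \<and> h u < h x} \<union> {x. x \<notin> S \<and> h x \<le> h u})"
    and lap: "\<And>x. x \<in> S \<Longrightarrow> h u < h x \<Longrightarrow> laplacian E h x = 0"
      "\<And>x. x \<notin> S \<Longrightarrow> h x \<le> h u \<Longrightarrow> laplacian E h x = 0"
  shows "h v - h u \<le> flux E h S"
proof -
  let ?T = "{x. h x \<le> h u}"
  have eq: "S - ?T \<union> (?T - S) = {x. x \<in> S \<and> h u < h x} \<union> {x. x \<notin> S \<and> h x \<le> h u}"
    by auto
  have fin: "finite (edge_boundary E ?T)"
    using bd by (rule finite_edge_boundary_cong) (use D eq in simp)
  have "(\<lambda>(u, v). h v - h u) (u, v) \<le> flux E h ?T"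
    unfolding flux_def
    by (rule member_le_sum) (use assms fin in \<open>auto simp: edge_boundary_def\<close>)
  also have "flux E h ?T = flux E h S"
    using bd by (rule flux_cong) (use D eq lap in auto)
  finally show ?thesis by simp
qed

end

text \<open>One form for negation, scaling and linear combinations; the additive constant cancels in
  differences.\<close>

lemma flux_affine:
  "flux E (\<lambda>x. a * g x + b * h x + c) S = a * flux E g S + b * flux E h S"
  unfolding flux_def sum_distrib_left sum.distrib[symmetric]
  by (intro sum.cong) (auto simp: algebra_simps)

lemma laplacian_affine:
  "laplacian E (\<lambda>x. a * g x + b * h x + c) v = a * laplacian E g v + b * laplacian E h v"
  unfolding laplacian_def sum_distrib_left sum.distrib[symmetric]
  by (intro sum.cong) (auto simp: algebra_simps)

lemma lipschitz_walk:
  assumes "\<And>u v. E u v \<Longrightarrow> \<bar>h u - h v\<bar> \<le> C" and "(E ^^ n) x y"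
  shows "\<bar>h x - h y :: real\<bar> \<le> real n * C"
  using assms(2)
proof (induction n arbitrary: y)
  case (Suc n)
  then obtain z where "(E ^^ n) x z" "E z y" by auto
  with Suc.IH[of z] assms(1)[of z y] show ?case
    by (simp add: algebra_simps)
qed simp

lemma lipschitz_affine:
  assumes "lipschitz E h"
  shows "lipschitz E (\<lambda>x. a * h x + c)"
proof -
  obtain C where C: "\<And>u v. E v u \<Longrightarrow> \<bar>h v - h u\<bar> < C"
    using assms unfolding lipschitz_def by blast
  have "\<bar>(a * h v + c) - (a * h u + c)\<bar> < \<bar>a\<bar> * C + 1" if "E v u" for u v
  proof -
    have "\<bar>(a * h v + c) - (a * h u + c)\<bar> = \<bar>a\<bar> * \<bar>h v - h u\<bar>"
      by (simp add: abs_mult[symmetric] right_diff_distrib)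
    also have "\<dots> \<le> \<bar>a\<bar> * C"
      using C[OF that] by (intro mult_left_mono) auto
    finally show ?thesis by simp
  qed
  then show ?thesis unfolding lipschitz_def by blast
qed

section \<open>Unboundedness of harmonic functions and the Dirichlet problem\<close>

context lfc_graph
begin

lemma harmonic_affine:
  assumes "harmonic E h"
  shows "harmonic E (\<lambda>x. a * h x + c)"
  using assms laplacian_affine[of E 0 h a h c] by (simp add: harmonic_iff_laplacian)

text \<open>If \<open>T\<close> bounded \<open>h\<close> from above, \<open>T - h\<close> would be
  nonnegative and harmonic, hence constant.\<close>

lemma harmonic_nonconstant_unbounded:
  assumes "recurrent E" and harm: "harmonic E h" and "h x \<noteq> h y"
  shows "\<exists>z. T < h z"
proof (rule ccontr)
  assume "\<not> ?thesis"
  then have "-1 * h x + T = -1 * h y + T"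
    by (intro liouville_nonneg[OF assms(1) harmonic_affine[OF harm]]) (simp add: not_less)
  then show False using assms(3) by simp
qed

text \<open>The solution is the increasing limit of the value iteration started at \<open>\<phi>\<close>.\<close>

lemma dirichlet_problem:
  fixes \<phi> :: "'v \<Rightarrow> real"
  assumes \<phi>: "\<And>x. 0 \<le> \<phi> x" "\<And>x. \<phi> x \<le> 1" and \<phi>W: "\<And>x. x \<in> W \<Longrightarrow> \<phi> x = 0"
  obtains h where "\<And>x. 0 \<le> h x" "\<And>x. h x \<le> 1" "\<And>x. x \<notin> W \<Longrightarrow> h x = \<phi> x"
    "\<And>x. x \<in> W \<Longrightarrow> laplacian E h x = 0"
proof -
  define step where "step h = (\<lambda>x. if x \<in> W then (\<Sum>y\<in>nbrs E x. h y) / real (graph_degree E x) else \<phi> x)"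
    for h :: "'v \<Rightarrow> real"
  define H where "H n = (step ^^ n) \<phi>" for n
  have H_Suc: "H (Suc n) = step (H n)" for n by (simp add: H_def)
  have bounds: "0 \<le> H n x \<and> H n x \<le> 1" for n x
  proof (induction n arbitrary: x)
    case 0
    then show ?case using \<phi> by (simp add: H_def)
  next
    case (Suc n)
    have "(\<Sum>y\<in>nbrs E x. H n y) \<le> (\<Sum>y\<in>nbrs E x. 1)"
      using Suc by (intro sum_mono) auto
    then show ?case
      using \<phi> Suc degree_pos[of x]
      by (auto simp: H_Suc step_def graph_degree_def intro!: divide_nonneg_nonneg sum_nonneg)
  qed
  \<comment> \<open>The first step decreases nothing because \<open>\<phi>\<close> is 0 on
    \<open>W\<close>; afterwards averaging preserves the order.\<close>
  have mono: "H n x \<le> H (Suc n) x" for n x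
  proof (induction n arbitrary: x)
    case 0
    show ?case
    proof (cases "x \<in> W")
      case True
      then show ?thesis using bounds[of "Suc 0" x] \<phi>W by (simp add: H_def)
    qed (simp add: H_def step_def)
  next
    case (Suc n)
    have "step (H n) x \<le> step (H (Suc n)) x"
      unfolding step_def using Suc by (simp add: divide_right_mono sum_mono)
    then show ?case by (simp only: H_Suc)
  qed
  have "convergent (\<lambda>n. H n x)" for x
    using incseq_convergent[of "\<lambda>n. H n x" 1] mono bounds
    by (metis convergentI incseq_SucI)
  then obtain h where h: "\<And>x. (\<lambda>n. H n x) \<longlonglongrightarrow> h x"
    unfolding convergent_def by metis
  have eq: "h x = step h x" for x
  proof (rule LIMSEQ_unique[OF LIMSEQ_Suc[OF h]])
    show "(\<lambda>n. H (Suc n) x) \<longlonglongrightarrow> step h x"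
      using degree_pos[of x] unfolding H_Suc step_def
      by (cases "x \<in> W") (auto intro!: tendsto_intros h)
  qed
  show ?thesis
  proof
    show "0 \<le> h x" for x
      using h[of x] by (rule LIMSEQ_le_const) (use bounds in blast)
    show "h x \<le> 1" for x
      using h[of x] by (rule LIMSEQ_le_const2) (use bounds in blast)
    show "h x = \<phi> x" if "x \<notin> W" for x
      using eq[of x] that by (simp add: step_def)
    show "laplacian E h x = 0" if "x \<in> W" for x
      unfolding laplacian_eq_0_iff using eq[of x] that unfolding step_def by simp
  qed
qed

end

section \<open>Line-like graphs\<close>

text \<open>\<open>f\<close> is a coordinate along the line. The same \<open>B\<close> bounds its
  change along an edge and the width of a slice, so an edge crossing the level of a vertex starts
  within bounded distance of that vertex.\<close>

locale line_like_graph = lfc_graph E for E :: "'v \<Rightarrow> 'v \<Rightarrow> bool" +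
  fixes f :: "'v \<Rightarrow> real" and B :: real
  assumes f_step: "E u v \<Longrightarrow> \<bar>f u - f v\<bar> \<le> B"
    and finite_slab: "finite {x. \<bar>f x\<bar> \<le> r}"
    and slice_diam: "\<exists>D. \<forall>x y. \<bar>f x - f y\<bar> \<le> B \<longrightarrow> (\<exists>n\<le>D. (E ^^ n) x y)"
    and unbounded_above: "\<exists>x. r \<le> f x"
    and unbounded_below: "\<exists>x. f x \<le> r"
begin

text \<open>Exchanges the two ends, so that results at the right end transfer to the left.\<close>

lemma reflected: "line_like_graph E (\<lambda>x. - f x) B"
proof unfold_locales
  show "\<bar>- f u - - f v\<bar> \<le> B" if "E u v" for u v
    using f_step[OF that] by simp
  show "finite {x. \<bar>- f x\<bar> \<le> r}" for r
    using finite_slab by simp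
  show "\<exists>D. \<forall>x y. \<bar>- f x - - f y\<bar> \<le> B \<longrightarrow> (\<exists>n\<le>D. (E ^^ n) x y)"
    using slice_diam by (simp add: abs_minus_commute)
  show "\<exists>x. r \<le> - f x" for r
    using unbounded_below[of "-r"] by (simp add: le_minus_iff)
  show "\<exists>x. - f x \<le> r" for r
    using unbounded_above[of "-r"] by (simp add: minus_le_iff)
qed

lemma finite_between: "finite {x. a \<le> f x \<and> f x \<le> b}"
  by (rule finite_subset[OF _ finite_slab[of "\<bar>a\<bar> + \<bar>b\<bar>"]]) auto

lemma finite_edge_boundary_left: "finite (edge_boundary E {x. f x < 0})"
proof (rule finite_subset)
  show "edge_boundary E {x. f x < 0} \<subseteq> {x. \<bar>f x\<bar> \<le> B} \<times> {x. \<bar>f x\<bar> \<le> B}"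
    using f_step by (fastforce simp: edge_boundary_def)
qed (use finite_slab in blast)

lemma lipschitz_slice_oscillation:
  assumes "lipschitz E h"
  shows "\<exists>K. \<forall>x y. \<bar>f x - f y\<bar> \<le> B \<longrightarrow> \<bar>h x - h y\<bar> \<le> K"
proof -
  obtain C where "\<And>u v. E v u \<Longrightarrow> \<bar>h v - h u\<bar> < C"
    using assms unfolding lipschitz_def by blast
  then have C: "\<And>u v. E u v \<Longrightarrow> \<bar>h u - h v\<bar> \<le> \<bar>C\<bar>"
    by fastforce
  obtain D where D: "\<And>x y. \<bar>f x - f y\<bar> \<le> B \<Longrightarrow> \<exists>n\<le>D. (E ^^ n) x y"
    using slice_diam by blast
  have "\<bar>h x - h y\<bar> \<le> real D * \<bar>C\<bar>" if xy: "\<bar>f x - f y\<bar> \<le> B" for x y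
  proof -
    obtain n where "n \<le> D" "(E ^^ n) x y" using D[OF xy] by blast
    then have "\<bar>h x - h y\<bar> \<le> real n * \<bar>C\<bar>" using lipschitz_walk C by metis
    also have "\<dots> \<le> real D * \<bar>C\<bar>" using \<open>n \<le> D\<close> by (intro mult_right_mono) auto
    finally show ?thesis .
  qed
  then show ?thesis by blast
qed

section \<open>Growth at the ends and nonvanishing flux\<close>

text \<open>Any \<open>y\<close> beyond a vertex \<open>x\<close> of large value lies between
  \<open>x\<close> and a farther vertex \<open>z\<close> of large value. Up to \<open>K\<close>,
  \<open>h\<close> is large on the slices of both, and the minimum principle carries this to
  \<open>y\<close>.\<close>

lemma tends_to_infinity_right:
  assumes harm: "harmonic E h" and "lipschitz E h" and unb: "\<And>T. \<exists>x. 0 \<le> f x \<and> T < h x"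
  shows "finite {x. 0 \<le> f x \<and> h x \<le> t}"
proof -
  obtain K where K: "\<And>x y. \<bar>f x - f y\<bar> \<le> B \<Longrightarrow> \<bar>h x - h y\<bar> \<le> K"
    using lipschitz_slice_oscillation[OF assms(2)] by blast
  obtain x where x: "0 \<le> f x" "t + K < h x" using unb by blast
  have large: "t < h y" if y: "f x \<le> f y" for y
  proof -
    let ?Y = "{w. 0 \<le> f w \<and> f w \<le> f y}"
    have "bdd_above (h ` ?Y)" using finite_between by (intro bdd_above_finite finite_imageI)
    then obtain T where T: "\<And>w. w \<in> ?Y \<Longrightarrow> h w \<le> T" unfolding bdd_above_def by blast
    \<comment> \<open>\<open>T\<close> bounds \<open>h\<close> as far as \<open>y\<close>, which
      forces \<open>z\<close> beyond \<open>y\<close>; \<open>t + K\<close> allows for the loss of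
      \<open>K\<close> in the slice of \<open>z\<close>.\<close>
    obtain z where z: "0 \<le> f z" "max T (t + K) < h z" using unb by blast
    have yz: "f y < f z" using T[of z] z by force
    let ?W = "{w. f x \<le> f w \<and> f w \<le> f z}"
    have "min (h x) (h z) - K \<le> h y"
    proof (rule minimum_principle[OF harm finite_between])
      show "y \<in> ?W" using y yz by simp
      fix w assume w: "w \<in> ?W"
      show "min (h x) (h z) - K \<le> h w \<or> nbrs E w \<subseteq> ?W"
      proof (rule disjCI)
        assume "\<not> nbrs E w \<subseteq> ?W"
        then obtain u where u: "E w u" "f u < f x \<or> f z < f u"
          by (force simp: nbrs_def not_le)
        then have "\<bar>f w - f x\<bar> \<le> B \<or> \<bar>f w - f z\<bar> \<le> B"
          using f_step[OF u(1)] w by auto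
        then show "min (h x) (h z) - K \<le> h w"
          using K[of w x] K[of w z] by linarith
      qed
    qed
    then show ?thesis using x z by linarith
  qed
  have "f w \<le> f x" if "h w \<le> t" for w
    using large[of w] that by linarith
  then show ?thesis
    by (intro finite_subset[OF _ finite_between[of 0 "f x"]]) auto
qed

lemma tends_to_infinity_left:
  assumes "harmonic E h" and "lipschitz E h" and "\<And>T. \<exists>x. f x \<le> 0 \<and> T < h x"
  shows "finite {x. f x \<le> 0 \<and> h x \<le> t}"
proof -
  interpret r: line_like_graph E "\<lambda>x. - f x" B by (rule reflected)
  show ?thesis using r.tends_to_infinity_right[OF assms(1,2), of t] assms(3) by simp
qed

text \<open>The growth assumptions make every sublevel set a finite modification of the left half,
  so one rising edge forces positive flux.\<close>

lemma flux_pos: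
  assumes harm: "harmonic E h" and "h x \<noteq> h y"
    and "\<And>t. finite {x. 0 \<le> f x \<and> h x \<le> t}" and "\<And>t. finite {x. f x \<le> 0 \<and> t \<le> h x}"
  shows "0 < flux E h {x. f x < 0}"
proof -
  obtain u v where uv: "E u v" "h u < h v"
    using nonconstant_imp_edge[OF assms(2)] by blast
  have "finite ({x. x \<in> {x. f x < 0} \<and> h u < h x} \<union> {x. x \<notin> {x. f x < 0} \<and> h x \<le> h u})"
    by (rule finite_subset[OF _ finite_UnI[OF assms(3)[of "h u"] assms(4)[of "h u"]]]) auto
  then have "h v - h u \<le> flux E h {x. f x < 0}"
    using harm by (intro edge_le_flux finite_edge_boundary_left uv) (auto simp: harmonic_iff_laplacian)
  then show ?thesis using uv by simp
qed

text \<open>By recurrence \<open>h\<close> is unbounded above, hence at one of the ends. It tends to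
  infinity there, so it must be unbounded below at the other end. A change of sign reduces the left
  end to the right.\<close>

lemma flux_nonzero:
  assumes rec: "recurrent E" and harm: "harmonic E h" and lip: "lipschitz E h" and ne: "h x \<noteq> h y"
  shows "flux E h {x. f x < 0} \<noteq> 0"
proof -
  have pos: "0 < flux E g {x. f x < 0}"
    if g: "harmonic E g" "lipschitz E g" "g x \<noteq> g y" and right: "\<And>T. \<exists>x. 0 \<le> f x \<and> T < g x" for g
  proof (rule flux_pos[OF g(1,3)])
    show fin: "finite {x. 0 \<le> f x \<and> g x \<le> t}" for t
      using tends_to_infinity_right[OF g(1,2) right] .
    have g': "harmonic E (\<lambda>x. -1 * g x + 0)" "lipschitz E (\<lambda>x. -1 * g x + 0)"
      using harmonic_affine[OF g(1)] lipschitz_affine[OF g(2)] by blast+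
    have "bdd_below (g ` {x. 0 \<le> f x \<and> g x \<le> 0})"
      using fin by (intro bdd_below_finite finite_imageI)
    then obtain m where m: "\<And>x. 0 \<le> f x \<Longrightarrow> g x \<le> 0 \<Longrightarrow> m \<le> g x"
      unfolding bdd_below_def by blast
    have "\<exists>x. f x \<le> 0 \<and> T < -1 * g x + 0" for T
    proof -
      \<comment> \<open>The bound puts \<open>g z\<close> below 0, \<open>m\<close> and
        \<open>-T\<close>: the first two exclude \<open>0 \<le> f z\<close>, the third is the
        claim.\<close>
      obtain z where z: "max T (max 0 (- m)) < -1 * g z + 0"
        using harmonic_nonconstant_unbounded[OF rec g'(1), of x y "max T (max 0 (- m))"] g(3) by force
      then have "\<not> 0 \<le> f z" using m[of z] by auto
      then show ?thesis using z by (intro exI[of _ z]) auto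
    qed
    from tends_to_infinity_left[OF g' this, of "-t" for t]
    show "finite {x. f x \<le> 0 \<and> t \<le> g x}" for t by simp
  qed
  \<comment> \<open>Upper bounds on both halves would bound \<open>h\<close> on the whole
    graph.\<close>
  consider "\<And>T. \<exists>x. 0 \<le> f x \<and> T < h x" | "\<And>T. \<exists>x. f x \<le> 0 \<and> T < h x"
    using harmonic_nonconstant_unbounded[OF rec harm ne]
    by (metis linorder_le_cases max_less_iff_conj)
  then show ?thesis
  proof cases
    case 1
    then show ?thesis using pos[OF harm lip ne] by simp
  next
    case 2
    have h': "harmonic E (\<lambda>x. -1 * h x + 0)" "lipschitz E (\<lambda>x. -1 * h x + 0)"
      using harmonic_affine[OF harm] lipschitz_affine[OF lip] by blast+
    have fin: "finite {x. f x \<le> 0 \<and> h x \<le> t}" for t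
      using tends_to_infinity_left[OF harm lip 2] .
    have "bdd_below (h ` {x. f x \<le> 0 \<and> h x \<le> 0})"
      using fin by (intro bdd_below_finite finite_imageI)
    then obtain m where m: "\<And>x. f x \<le> 0 \<Longrightarrow> h x \<le> 0 \<Longrightarrow> m \<le> h x"
      unfolding bdd_below_def by blast
    have "\<exists>x. 0 \<le> f x \<and> T < -1 * h x + 0" for T
    proof -
      obtain z where z: "max T (max 0 (- m)) < -1 * h z + 0"
        using harmonic_nonconstant_unbounded[OF rec h'(1), of x y "max T (max 0 (- m))"] ne by force
      then have "\<not> f z \<le> 0" using m[of z] by auto
      then show ?thesis using z by (intro exI[of _ z]) auto
    qed
    then have "0 < flux E (\<lambda>x. -1 * h x + 0) {x. f x < 0}"
      using ne by (intro pos h') auto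
    then show ?thesis using flux_affine[of E 0 h "-1" h 0] by simp
  qed
qed

section \<open>Existence of a function with unit flux\<close>

text \<open>With values 0 to the left and 1 to the right of the window, the sublevel set at the
  lower end of a rising edge differs from the left half only inside the window. So the flux bounds
  every rise, and one divides by it.\<close>

lemma unit_flux_window:
  obtains g where "\<And>x. \<bar>f x\<bar> < r \<Longrightarrow> laplacian E g x = 0" "flux E g {x. f x < 0} = 1"
    "\<And>u v. E u v \<Longrightarrow> \<bar>g u - g v\<bar> \<le> 1"
proof -
  \<comment> \<open>\<open>s\<close> is positive, so that the two sides of the window lie in
    different halves.\<close>
  define s where "s = max r 1"
  let ?W = "{x. \<bar>f x\<bar> < s}"
  let ?\<phi> = "\<lambda>x. if s \<le> f x then 1 else 0 :: real"
  have \<phi>: "0 \<le> ?\<phi> x" "?\<phi> x \<le> 1" "x \<in> ?W \<Longrightarrow> ?\<phi> x = 0" for x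
    by auto
  obtain h where h: "\<And>x. 0 \<le> h x" "\<And>x. h x \<le> 1"
    "\<And>x. x \<notin> ?W \<Longrightarrow> h x = ?\<phi> x" "\<And>x. x \<in> ?W \<Longrightarrow> laplacian E h x = 0"
    using dirichlet_problem[of ?\<phi> ?W, OF \<phi>] by blast
  let ?F = "flux E h {x. f x < 0}"
  have edge: "h v - h u \<le> ?F" if uv: "E u v" "h u < h v" for u v
  proof (rule edge_le_flux[OF finite_edge_boundary_left uv])
    have left: "x \<in> ?W" if "x \<in> {x. f x < 0}" "h u < h x" for x
      using that h(3)[of x] h(1)[of u] by (force simp: s_def)
    have right: "x \<in> ?W" if "x \<notin> {x. f x < 0}" "h x \<le> h u" for x
    proof (rule ccontr)
      assume x: "x \<notin> ?W"
      then have "h x = 1" using that h(3)[OF x] by auto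
      then show False using that h(2)[of v] uv(2) by simp
    qed
    show "finite ({x. x \<in> {x. f x < 0} \<and> h u < h x} \<union> {x. x \<notin> {x. f x < 0} \<and> h x \<le> h u})"
      by (rule finite_subset[OF _ finite_slab[of s]]) (use left right in fastforce)
    show "laplacian E h x = 0" if "x \<in> {x. f x < 0}" "h u < h x" for x
      using h(4) left[OF that] .
    show "laplacian E h x = 0" if "x \<notin> {x. f x < 0}" "h x \<le> h u" for x
      using h(4) right[OF that] .
  qed
  obtain x y where "s \<le> f x" "f y \<le> -s"
    using unbounded_above unbounded_below by metis
  moreover have "1 \<le> s" by (simp add: s_def)
  ultimately have "h x \<noteq> h y" using h(3)[of x] h(3)[of y] by auto
  then have F: "0 < ?F" using edge by (metis nonconstant_imp_edge diff_gt_0_iff_gt order_less_le_trans)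
  show ?thesis
  proof
    show "laplacian E (\<lambda>x. 0 * h x + 1 / ?F * h x + 0) x = 0" if "\<bar>f x\<bar> < r" for x
      unfolding laplacian_affine using h(4)[of x] that by (simp add: s_def)
    show "flux E (\<lambda>x. 0 * h x + 1 / ?F * h x + 0) {x. f x < 0} = 1"
      unfolding flux_affine using F by simp
    fix u v assume uv: "E u v"
    have "\<bar>h u - h v\<bar> \<le> ?F"
      using edge[OF uv] edge[OF sym[OF uv]] F by linarith
    then have "\<bar>(h u - h v) / ?F\<bar> \<le> 1" using F by simp
    then show "\<bar>(0 * h u + 1 / ?F * h u + 0) - (0 * h v + 1 / ?F * h v + 0)\<bar> \<le> 1"
      by (simp add: diff_divide_distrib)
  qed
qed

lemma countable_verts: "countable (UNIV :: 'v set)"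
proof -
  have "(UNIV :: 'v set) = (\<Union>n. {x. \<bar>f x\<bar> \<le> real n})"
    using real_arch_simple by fastforce
  moreover have "countable (\<Union>n. {x. \<bar>f x\<bar> \<le> real n})"
    by (rule countable_UN) (auto intro: countable_finite finite_slab)
  ultimately show ?thesis by simp
qed

text \<open>A subsequence of the solutions on growing windows converges pointwise; the finite sums
  at a vertex and over the cut pass to the limit.\<close>

lemma exists_unit_flux:
  obtains g where "g \<in> LH E" "flux E g {x. f x < 0} = 1"
proof -
  have "\<exists>g. (\<forall>x. \<bar>f x\<bar> < real n \<longrightarrow> laplacian E g x = 0) \<and> flux E g {x. f x < 0} = 1
      \<and> (\<forall>u v. E u v \<longrightarrow> \<bar>g u - g v\<bar> \<le> 1)" for n :: nat
    using unit_flux_window[of "real n"] by metis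
  then obtain G where G: "\<And>n x. \<bar>f x\<bar> < real n \<Longrightarrow> laplacian E (G n) x = 0"
    "\<And>n. flux E (G n) {x. f x < 0} = 1" "\<And>n u v. E u v \<Longrightarrow> \<bar>G n u - G n v\<bar> \<le> 1"
    by metis
  obtain b where "0 \<le> f b" using unbounded_above by blast
  have "\<exists>n. (E ^^ n) b x" for x using connected rtranclp_power by metis
  then obtain N where N: "\<And>x. (E ^^ N x) b x" by metis
  \<comment> \<open>Pinning the value at \<open>b\<close> bounds each value by the length
    \<open>N x\<close> of a walk and changes neither Laplacian nor flux.\<close>
  define H where "H n x = G n x - G n b" for n x
  have H_le: "\<bar>H n x\<bar> \<le> real (N x)" for n x
    using lipschitz_walk[of E "G n" 1, OF G(3) N[of x]] by (simp add: H_def abs_minus_commute)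
  \<comment> \<open>\<open>function_convergent_subsequence\<close> asks for one bound at all
    vertices, hence the weights; the added 1 keeps the denominator positive when
    \<open>N x = 0\<close>.\<close>
  obtain k where k: "strict_mono k" "\<And>x. \<exists>l. (\<lambda>n. H (k n) x / (1 + real (N x))) \<longlonglongrightarrow> l"
  proof (rule function_convergent_subsequence[OF countable_verts, of "\<lambda>n x. H n x / (1 + real (N x))" 1])
    show "norm (H n x / (1 + real (N x))) \<le> 1" for n x
      using H_le[of n x] by simp
  qed blast
  have "\<exists>l. (\<lambda>n. H (k n) x) \<longlonglongrightarrow> l" for x
  proof -
    obtain l where "(\<lambda>n. H (k n) x / (1 + real (N x))) \<longlonglongrightarrow> l" using k(2) by blast
    from tendsto_mult_right[OF this, of "1 + real (N x)"]
    have "(\<lambda>n. H (k n) x) \<longlonglongrightarrow> l * (1 + real (N x))"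
      by (simp add: nonzero_divide_mult_cancel_right add_nonneg_eq_0_iff)
    then show ?thesis by blast
  qed
  then obtain g where g: "\<And>x. (\<lambda>n. H (k n) x) \<longlonglongrightarrow> g x" by metis
  have "laplacian E g x = 0" for x
  proof (rule LIMSEQ_unique)
    show "(\<lambda>n. laplacian E (H (k n)) x) \<longlonglongrightarrow> laplacian E g x"
      unfolding laplacian_def by (intro tendsto_intros g)
    \<comment> \<open>From this index on, \<open>x\<close> lies in the window of index
      \<open>k n\<close>, which is at least \<open>n\<close>.\<close>
    have "laplacian E (H (k n)) x = 0" if "nat \<lceil>\<bar>f x\<bar>\<rceil> + 1 \<le> n" for n
    proof -
      have "n \<le> k n" using k(1) by (rule strict_mono_imp_increasing)
      then have "\<bar>f x\<bar> < real (k n)" using that by linarith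
      then show ?thesis using G(1)[of x "k n"] by (simp add: H_def laplacian_def)
    qed
    then show "(\<lambda>n. laplacian E (H (k n)) x) \<longlonglongrightarrow> 0"
      by (intro tendsto_eventually) (auto simp: eventually_sequentially)
  qed
  moreover have "\<bar>g u - g v\<bar> \<le> 1" if "E u v" for u v
  proof (rule LIMSEQ_le_const2)
    show "(\<lambda>n. \<bar>H (k n) u - H (k n) v\<bar>) \<longlonglongrightarrow> \<bar>g u - g v\<bar>"
      by (intro tendsto_intros g)
  qed (use G(3)[OF that] in \<open>auto simp: H_def\<close>)
  \<comment> \<open>\<open>lipschitz\<close> asks for a strict inequality, hence 2 rather than
    1.\<close>
  then have "\<forall>u v. E v u \<longrightarrow> \<bar>g v - g u\<bar> < 2" by force
  moreover have "flux E g {x. f x < 0} = 1"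
  proof (rule LIMSEQ_unique)
    show "(\<lambda>n. flux E (H (k n)) {x. f x < 0}) \<longlonglongrightarrow> flux E g {x. f x < 0}"
      unfolding flux_def case_prod_unfold by (intro tendsto_intros g)
    show "(\<lambda>n. flux E (H (k n)) {x. f x < 0}) \<longlonglongrightarrow> 1"
      using G(2) by (simp add: flux_def H_def)
  qed
  ultimately show ?thesis
    using that[of g] by (auto simp: LH_def lipschitz_def harmonic_iff_laplacian)
qed

section \<open>The dimension count\<close>

lemma dim_LH:
  assumes "recurrent E"
  shows "dim (LH E) = 2"
proof -
  obtain g where g: "g \<in> LH E" "flux E g {x. f x < 0} = 1" by (rule exists_unit_flux)
  let ?one = "\<lambda>_ :: 'v. 1 :: real"
  have one_LH: "?one \<in> LH E"
    by (auto simp: LH_def harmonic_iff_laplacian laplacian_def lipschitz_def intro: exI[of _ 1])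
  have g_not: "g \<notin> span {?one}"
  proof
    assume "g \<in> span {?one}"
    then obtain c where "g = c *\<^sub>R ?one" by (auto simp: span_singleton)
    then show False using g(2) by (simp add: flux_def scaleR_fun_def)
  qed
  show ?thesis
  proof (rule dim_unique)
    show "{g, ?one} \<subseteq> LH E" using g one_LH by simp
    have "?one \<noteq> 0" by (auto simp: fun_eq_iff)
    then show "independent {g, ?one}"
      using g_not by (simp add: independent_insert)
    show "card {g, ?one} = 2"
      using g_not span_base[of ?one "{?one}"] by (auto simp: card_insert_if)
    show "LH E \<subseteq> span {g, ?one}"
    proof
      fix h assume h: "h \<in> LH E"
      let ?F = "flux E h {x. f x < 0}"
      \<comment> \<open>The flux of \<open>h\<close> is its coefficient at \<open>g\<close>: the
        remainder has zero flux and is therefore constant.\<close>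
      let ?h = "h - ?F *\<^sub>R g"
      have "?h \<in> LH E"
        using h g subspace_LH by (intro subspace_diff subspace_scale)
      moreover have "flux E ?h {x. f x < 0} = 0"
        using flux_affine[of E 1 h "- ?F" g 0] g(2)
        by (simp add: scaleR_fun_def fun_diff_def)
      ultimately have "?h x = ?h y" for x y
        using flux_nonzero[OF assms, of ?h] unfolding LH_def by blast
      then have "\<exists>c. \<forall>x. ?h x = c" by blast
      then obtain c where "\<And>x. ?h x = c" by blast
      then have "h = ?F *\<^sub>R g + c *\<^sub>R ?one"
        by (auto simp: fun_eq_iff scaleR_fun_def algebra_simps)
      also have "\<dots> \<in> span {g, ?one}"
        by (intro span_add span_scale span_base) auto
      finally show "h \<in> span {g, ?one}" .
    qed
  qed
qed

end

section \<open>From the quasi-isometry to a line-like graph\<close>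

lemma finite_relpowp:
  assumes "\<And>z. finite (nbrs E z)"
  shows "finite {y. (E ^^ n) x y}"
proof (induction n)
  case (Suc n)
  have "{y. (E ^^ Suc n) x y} \<subseteq> (\<Union>z\<in>{y. (E ^^ n) x y}. nbrs E z)"
    by (auto simp: nbrs_def)
  then show ?case using Suc assms by (meson finite_UN finite_subset)
qed simp

theorem theorem1p1:
  fixes E :: "'v \<Rightarrow> 'v \<Rightarrow> bool"
  assumes "simple_graph E" and "connected_graph E"
    and "locally_finite E"
    and "recurrent E"
    and "quasi_isometric (graph_dist E) (dist :: real \<Rightarrow> real \<Rightarrow> real)"
  shows "dim (LH E) = 2"
proof -
  obtain f :: "'v \<Rightarrow> real" and M A where M: "M \<ge> 1" and A: "A \<ge> 0"
    and lower: "\<And>x y. inverse M * graph_dist E x y - A \<le> \<bar>f x - f y\<bar>"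
    and upper: "\<And>x y. \<bar>f x - f y\<bar> \<le> M * graph_dist E x y + A"
    and dense: "\<And>z. \<exists>x. \<bar>z - f x\<bar> \<le> A"
    using assms(5) unfolding quasi_isometric_def quasi_isometry_def dist_real_def by blast
  have fin: "finite (nbrs E z)" for z
    using assms(3) by (simp add: locally_finite_def)
  have walk: "\<exists>n. real n = graph_dist E x y \<and> (E ^^ n) x y" for x y
  proof -
    have "\<exists>n. (E ^^ n) x y"
      using assms(2) unfolding connected_graph_def by (metis rtranclp_power)
    then have "(E ^^ (LEAST n. (E ^^ n) x y)) x y" by (rule LeastI_ex)
    then show ?thesis unfolding graph_dist_def by blast
  qed
  \<comment> \<open>Solving the lower quasi-isometry bound for the distance turns closeness under
    \<open>f\<close> into a short walk. This gives both finite slabs and bounded slices.\<close>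
  have close: "\<exists>n \<le> nat \<lfloor>M * (r + A)\<rfloor>. (E ^^ n) x y" if "\<bar>f x - f y\<bar> \<le> r" for x y r
  proof -
    obtain n where n: "real n = graph_dist E x y" "(E ^^ n) x y" using walk by blast
    have "inverse M * real n \<le> r + A" using lower[of x y, folded n(1)] that by linarith
    then have "real n \<le> M * (r + A)" using M by (simp add: field_simps)
    then have "n \<le> nat \<lfloor>M * (r + A)\<rfloor>" by (simp add: le_nat_floor)
    then show ?thesis using n by blast
  qed
  \<comment> \<open>Aiming \<open>A\<close> beyond \<open>r\<close> absorbs the error in the density
    of the image.\<close>
  have above: "\<exists>x. r \<le> f x" for r
    using dense[of "r + A"] by (auto simp: abs_le_iff algebra_simps)
  have below: "\<exists>x. f x \<le> r" for r
    using dense[of "r - A"] by (auto simp: abs_le_iff algebra_simps)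
  interpret line_like_graph E f "M + A"
  proof
    show "E v u" if "E u v" for u v
      using that assms(1) by (simp add: simple_graph_def sympD)
    show "\<not> E u u" for u
      using assms(1) by (simp add: simple_graph_def irreflpD)
    show "E\<^sup>*\<^sup>* u v" for u v
      using assms(2) by (simp add: connected_graph_def)
    show "finite (nbrs E u)" for u by (rule fin)
    show "infinite (UNIV :: 'v set)"
    proof
      assume "finite (UNIV :: 'v set)"
      then have "bdd_above (range f)" by (intro bdd_above_finite finite_imageI)
      then obtain m where "\<And>x. f x \<le> m" unfolding bdd_above_def by blast
      then show False using above[of "m + 1"] by (meson not_less le_add_same_cancel1 add_le_same_cancel1 not_one_le_zero order_trans)
    qed
    show "\<bar>f u - f v\<bar> \<le> M + A" if "E u v" for u v
    proof -
      have "(E ^^ 1) u v" using that by (simp add: eq_OO)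
      then have "(LEAST n. (E ^^ n) u v) \<le> 1" by (rule Least_le)
      then have "graph_dist E u v \<le> 1" by (simp add: graph_dist_def)
      then have "M * graph_dist E u v \<le> M * 1" using M by (intro mult_left_mono) auto
      then show ?thesis using upper[of u v] by simp
    qed
    show "finite {x. \<bar>f x\<bar> \<le> r}" for r
    proof -
      \<comment> \<open>The slab lies in a ball around \<open>b\<close>, which is finite by local
        finiteness.\<close>
      obtain b where "0 \<le> f b" using above by blast
      let ?D = "nat \<lfloor>M * (r + \<bar>f b\<bar> + A)\<rfloor>"
      have "{x. \<bar>f x\<bar> \<le> r} \<subseteq> (\<Union>n\<le>?D. {y. (E ^^ n) b y})"
      proof
        fix x assume "x \<in> {x. \<bar>f x\<bar> \<le> r}"
        then have "\<bar>f b - f x\<bar> \<le> r + \<bar>f b\<bar>" by simp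
        from close[OF this] show "x \<in> (\<Union>n\<le>?D. {y. (E ^^ n) b y})" by blast
      qed
      then show ?thesis
        by (rule finite_subset) (use finite_relpowp[OF fin] in blast)
    qed
    show "\<exists>D. \<forall>x y. \<bar>f x - f y\<bar> \<le> M + A \<longrightarrow> (\<exists>n\<le>D. (E ^^ n) x y)"
      using close by blast
  qed (use above below in auto)
  show ?thesis using assms(4) by (rule dim_LH)
qed

end
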